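(* Let $f\in\mathcal{N}(\Omega)$ and let $\eta\in\mathrm{Lip}(\Omega)$ with $\eta\in\mathrm{Ker}(\mathcal{L}_f)$. Let $w(t,x):=w_{f+t\eta}(x)$ be the eigenfunction of $\mathcal{L}_{f+t\eta}$ associated with the eigenvalue $\lambda_{f+t\eta}$. Then $\frac{\partial}{\partial t}w(t,x)|_{t=0}$ is a constant function, independent of $x\in\Omega$.
   Context: Let $(M,d_M)$ be a compact metric space with $\mathrm{diam}(M)=1$, $\Omega:=M^{\mathbb{N}}$ with metric $d(x,y)=\sum_{n\ge1}2^{-n}d_M(x_n,y_n)$. $\mathrm{Lip}(\Omega)$ is the space of real Lipschitz functions on $\Omega$. Fix a Borel probability $\nu$ on $M$ with support $M$. For $f\in\mathrm{Lip}(\Omega)$ the Ruelle operator on $\mathrm{Lip}(\Omega)$ is $\mathcal{L}_f(w)(x)=\int_M e^{f(ax)}w(ax)\,d\nu(a)$, where $ax=(a,x_1,x_2,\dots)$, and $\mathrm{Ker}(\mathcal{L}_f)=\{w\in\mathrm{Lip}(\Omega):\mathcal{L}_f w=0\}$. By the Ruelle-Perron-Frobenius (RPF) theorem there are $\lambda_f>0$, a strictly positive $w_f\in\mathrm{Lip}(\Omega)$ and a Borel probability $\rho_f$ with $\mathcal{L}_f w_f=\lambda_f w_f$, $\mathcal{L}_f^*\rho_f=\lambda_f\rho_f$, where $w_f$ is normalized by $\int w_f\,d\rho_f=1$; $\lambda_f$ and $w_f$ depend analytically on $f$. $\mathcal{N}(\Omega)$ is the set of $f\in\mathrm{Lip}(\Omega)$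 with $\mathcal{L}_f1=1$ (normalized potentials). *)

theory Defs
  imports "HOL-Probability.Probability"
begin

text \<open>
  The compact metric space M is the whole type \<open>'a :: metric_space\<close>, and \<open>\<Omega>\<close> is the type
  \<open>nat \<Rightarrow> 'a\<close>, the coordinate \<open>x\<^sub>n\<close> (\<open>n \<ge> 1\<close>) being \<open>x (n - 1)\<close>.

  The metric of \<open>\<Omega>\<close> is \<open>seq_dist\<close>, not the overloaded \<open>dist\<close> of the function type, which has
  different weights. Both induce the product topology (the distances of M are bounded by 1), so
  the measurable space \<open>borel\<close> on \<open>nat \<Rightarrow> 'a\<close> is the Borel sigma-algebra of \<open>seq_dist\<close>.
\<close>

definition seq_dist :: "(nat \<Rightarrow> 'a::metric_space) \<Rightarrow> (nat \<Rightarrow> 'a) \<Rightarrow> real" where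
  "seq_dist x y = (\<Sum>n. (1/2) ^ Suc n * dist (x n) (y n))"

definition Lip :: "((nat \<Rightarrow> 'a::metric_space) \<Rightarrow> real) set" where
  "Lip = {w. \<exists>C. \<forall>x y. \<bar>w x - w y\<bar> \<le> C * seq_dist x y}"

definition measure_support :: "'b::topological_space measure \<Rightarrow> 'b set" where
  "measure_support \<mu> = {a. \<forall>U. open U \<and> a \<in> U \<longrightarrow> emeasure \<mu> U > 0}"

text \<open>The point \<open>ax = (a, x\<^sub>1, x\<^sub>2, \<dots>)\<close> is \<open>case_nat a x\<close>.\<close>

definition ruelle ::
  "'a measure \<Rightarrow> ((nat \<Rightarrow> 'a::metric_space) \<Rightarrow> real) \<Rightarrow> ((nat \<Rightarrow> 'a) \<Rightarrow> real) \<Rightarrow> (nat \<Rightarrow> 'a) \<Rightarrow> real" where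
  "ruelle \<nu> f w = (\<lambda>x. \<integral>a. exp (f (case_nat a x)) * w (case_nat a x) \<partial>\<nu>)"

definition ruelle_kernel ::
  "'a measure \<Rightarrow> ((nat \<Rightarrow> 'a::metric_space) \<Rightarrow> real) \<Rightarrow> ((nat \<Rightarrow> 'a) \<Rightarrow> real) set" where
  "ruelle_kernel \<nu> f = {w \<in> Lip. ruelle \<nu> f w = (\<lambda>x. 0)}"

definition normalized_potentials ::
  "'a measure \<Rightarrow> ((nat \<Rightarrow> 'a::metric_space) \<Rightarrow> real) set" where
  "normalized_potentials \<nu> = {f \<in> Lip. ruelle \<nu> f (\<lambda>x. 1) = (\<lambda>x. 1)}"

text \<open>
  \<open>rpf_triple \<nu> f l w \<rho>\<close>: the eigenvalue \<open>l\<close>, the eigenfunction \<open>w\<close> and the eigenprobability \<open>\<rho>\<close>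
  are those of the Ruelle-Perron-Frobenius theorem for the potential \<open>f\<close>. The equation
  \<open>L\<^sub>f\<^sup>* \<rho> = l \<rho>\<close> is spelled out by duality, on the space \<open>Lip\<close> on which the operator acts.
\<close>

definition rpf_triple ::
  "'a measure \<Rightarrow> ((nat \<Rightarrow> 'a::metric_space) \<Rightarrow> real) \<Rightarrow>
    real \<Rightarrow> ((nat \<Rightarrow> 'a) \<Rightarrow> real) \<Rightarrow> (nat \<Rightarrow> 'a) measure \<Rightarrow> bool" where
  "rpf_triple \<nu> f l w \<rho> \<longleftrightarrow>
     l > 0 \<and>
     w \<in> Lip \<and> (\<forall>x. w x > 0) \<and>
     prob_space \<rho> \<and> sets \<rho> = sets borel \<and>
     ruelle \<nu> f w = (\<lambda>x. l * w x) \<and>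
     (\<forall>u \<in> Lip. (\<integral>x. ruelle \<nu> f u x \<partial>\<rho>) = l * (\<integral>x. u x \<partial>\<rho>)) \<and>
     (\<integral>x. w x \<partial>\<rho>) = 1"

end

theory Submission
  imports Defs
begin

text \<open>
  For a normalized potential \<open>f\<close> the operator \<open>P = L\<^sub>f\<close> is Markov. With \<open>\<phi>\<close> as in \<open>phi\<close> below,
  \<open>\<phi> \<circ> seq_dist\<close> is comparable to \<open>seq_dist\<close> and \<open>P\<close> contracts by a factor \<open>\<kappa> < 1\<close> (\<open>contr\<close>) the best
  constant \<open>N(g)\<close> in \<open>\<bar>g x - g y\<bar> \<le> N(g) \<phi> (seq_dist x y)\<close>: couple the two chains from
  \<open>x\<close> and \<open>y\<close> by prepending the same symbol with the largest probability guaranteed by the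
  Lipschitz constant of \<open>f\<close>.

  Let \<open>w\<close> be the eigenfunction of \<open>f + t\<eta>\<close> and \<open>l\<close> its eigenvalue. Since \<open>P\<eta> = 0\<close>,
  \<open>l \<ge> 1\<close> and \<open>l w - 1 = P(e\<^bsup>t\<eta>\<^esup> w - 1 - t\<eta>)\<close>, so that
  \<open>N(w) \<le> \<kappa> (O(t\<^sup>2) + (1 + O(t)) N(w))\<close> and hence \<open>N(w) = O(t\<^sup>2)\<close>. As \<open>w\<close> has mean 1 for a
  probability, \<open>\<bar>w - 1\<bar>\<close> is at most the oscillation of \<open>w\<close>: it is \<open>O(t\<^sup>2)\<close>, and the derivative is 0.
\<close>

section \<open>The sequence metric and Lipschitz functions\<close>

lemma seq_dist_summable:
  fixes x y :: "nat \<Rightarrow> 'a::metric_space"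
  assumes "\<And>a b :: 'a. dist a b \<le> 1"
  shows "summable (\<lambda>n. (1/2) ^ Suc n * dist (x n) (y n))"
proof (rule summable_comparison_test)
  show "\<exists>N. \<forall>n\<ge>N. norm ((1/2) ^ Suc n * dist (x n) (y n)) \<le> (1/2::real) ^ Suc n"
    using assms by (auto simp: abs_mult intro!: mult_left_le)
  show "summable (\<lambda>n. (1/2::real) ^ Suc n)"
    using power_half_series by (rule sums_summable)
qed

lemma seq_dist_nonneg:
  fixes x y :: "nat \<Rightarrow> 'a::metric_space"
  assumes "\<And>a b :: 'a. dist a b \<le> 1"
  shows "0 \<le> seq_dist x y"
  unfolding seq_dist_def by (intro suminf_nonneg seq_dist_summable assms) auto

lemma seq_dist_le_1:
  fixes x y :: "nat \<Rightarrow> 'a::metric_space"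
  assumes "\<And>a b :: 'a. dist a b \<le> 1"
  shows "seq_dist x y \<le> 1"
proof -
  have "seq_dist x y \<le> (\<Sum>n. (1/2::real) ^ Suc n)"
    unfolding seq_dist_def
    by (intro suminf_le seq_dist_summable assms sums_summable[OF power_half_series] mult_left_le) auto
  then show ?thesis using sums_unique[OF power_half_series] by simp
qed

lemma seq_dist_commute: "seq_dist x y = seq_dist y x"
  by (simp add: seq_dist_def dist_commute)

text \<open>The weights are geometric, so the tail of the series is half of the original one. For
  \<open>a = b\<close> this halving drives the contraction.\<close>

lemma seq_dist_case_nat:
  fixes x y :: "nat \<Rightarrow> 'a::metric_space"
  assumes "\<And>a b :: 'a. dist a b \<le> 1"
  shows "seq_dist (case_nat a x) (case_nat b y) = dist a b / 2 + seq_dist x y / 2"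
proof -
  let ?h = "\<lambda>n. (1/2::real) ^ Suc n * dist (case_nat a x n) (case_nat b y n)"
  have "seq_dist (case_nat a x) (case_nat b y) = ?h 0 + (\<Sum>n. ?h (Suc n))"
    unfolding seq_dist_def
    using suminf_split_head[OF seq_dist_summable[OF assms, of "case_nat a x" "case_nat b y"]]
    by linarith
  also have "(\<Sum>n. ?h (Suc n)) = (\<Sum>n. (1/2) * ((1/2) ^ Suc n * dist (x n) (y n)))"
    by (simp add: mult.assoc)
  also have "\<dots> = seq_dist x y / 2"
    by (subst suminf_mult[OF seq_dist_summable[OF assms]]) (simp add: seq_dist_def)
  finally show ?thesis by simp
qed

lemma LipE:
  fixes g :: "(nat \<Rightarrow> 'a::metric_space) \<Rightarrow> real"
  assumes "\<And>a b :: 'a. dist a b \<le> 1" and "g \<in> Lip"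
  obtains C where "C \<ge> 0" "\<And>x y. \<bar>g x - g y\<bar> \<le> C * seq_dist x y"
proof -
  obtain C where C: "\<And>x y. \<bar>g x - g y\<bar> \<le> C * seq_dist x y"
    using assms(2) by (auto simp: Lip_def)
  have "\<bar>g x - g y\<bar> \<le> max C 0 * seq_dist x y" for x y
    using C[of x y] mult_right_mono[OF _ seq_dist_nonneg[OF assms(1), of x y], of C "max C 0"]
    by linarith
  then show ?thesis using that[of "max C 0"] by simp
qed

lemma Lip_bounded:
  fixes g :: "(nat \<Rightarrow> 'a::metric_space) \<Rightarrow> real"
  assumes "\<And>a b :: 'a. dist a b \<le> 1" and "g \<in> Lip"
  obtains B where "B \<ge> 0" "\<And>x. \<bar>g x\<bar> \<le> B"
proof -
  obtain C where C: "C \<ge> 0" "\<And>x y. \<bar>g x - g y\<bar> \<le> C * seq_dist x y"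
    using LipE[OF assms] by blast
  fix z
  have "\<bar>g x\<bar> \<le> \<bar>g z\<bar> + C" for x
    using C(2)[of x z] mult_left_le[OF seq_dist_le_1[OF assms(1), of x z] C(1)] by linarith
  then show ?thesis using that[of "\<bar>g z\<bar> + C"] C(1) by simp
qed

section \<open>The modulus of continuity \<open>phi\<close>\<close>

text \<open>
  With \<open>\<theta> = e\<^bsup>-Cs\<^esup>\<close>, the probability of coupling points at distance \<open>s\<close>, a one-step contraction
  amounts to \<open>\<theta> \<phi>(s/2) + 2 (1 - \<theta>) \<le> \<kappa> \<phi>(s)\<close>. For \<open>\<phi> = 2 - \<psi>\<close> this asks that \<open>\<theta> \<psi>(s/2)\<close>
  exceed \<open>\<psi>(s)\<close>; the factor \<open>e\<^bsup>-2Cs\<^esup>\<close> of \<open>\<psi>\<close> absorbs \<open>\<theta>\<close> and any decreasing linear factor does the rest.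
\<close>

definition phi :: "real \<Rightarrow> real \<Rightarrow> real" where
  "phi C s = 2 - exp (- 2 * C * s) * (2 - s)"

text \<open>The gain in \<open>phi_contraction\<close> is at least
  \<open>exp (- 2 * C) * s / 2\<close> and \<open>phi C s\<close> is at most
  \<open>(4 * C + 1) * s\<close>; their ratio is the amount subtracted.\<close>

definition contr :: "real \<Rightarrow> real" where
  "contr C = 1 - exp (- 2 * C) / (2 * (4 * C + 1))"

lemma contr_bounds:
  assumes "C \<ge> 0" shows "0 < contr C" "contr C < 1"
proof -
  have "exp (- 2 * C) \<le> 1" using assms by simp
  also have "1 < 2 * (4 * C + 1)" using assms by simp
  finally have "exp (- 2 * C) < 2 * (4 * C + 1)" .
  then show "0 < contr C" "contr C < 1" using assms by (auto simp: contr_def divide_simps)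
qed

lemma phi_le_2: "s \<le> 1 \<Longrightarrow> phi C s \<le> 2"
  by (simp add: phi_def)

text \<open>\<open>phi C s\<close> averages 2 and \<open>s\<close> with weight
  \<open>exp (- 2 * C * s)\<close> on \<open>s\<close>; the share of 2 is discarded.\<close>

lemma phi_ge:
  assumes "C \<ge> 0" "0 \<le> s" "s \<le> 1"
  shows "exp (- 2 * C) * s \<le> phi C s"
proof -
  have "exp (- 2 * C) * s \<le> exp (- 2 * C * s) * s"
    using assms by (intro mult_right_mono) (auto intro: mult_left_le)
  also have "\<dots> \<le> 2 * (1 - exp (- 2 * C * s)) + exp (- 2 * C * s) * s"
    using assms by simp
  also have "\<dots> = phi C s" by (simp add: phi_def algebra_simps)
  finally show ?thesis .
qed

lemma phi_nonneg:
  assumes "C \<ge> 0" "0 \<le> s" "s \<le> 1"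
  shows "0 \<le> phi C s"
  using phi_ge[OF assms] assms by (meson exp_ge_zero mult_nonneg_nonneg order_trans)

lemma phi_le:
  assumes "C \<ge> 0" "0 \<le> s"
  shows "phi C s \<le> (4 * C + 1) * s"
proof -
  have "1 + (- 2 * C * s) \<le> exp (- 2 * C * s)" by (rule exp_ge_add_one_self)
  moreover have "exp (- 2 * C * s) * s \<le> s"
    using assms by (simp add: mult_left_le_one_le)
  ultimately show ?thesis by (simp add: phi_def algebra_simps)
qed

text \<open>Passing from \<open>seq_dist\<close> to \<open>phi C\<close> costs only the factor
  \<open>exp (2 * C)\<close>, by \<open>phi_ge\<close>.\<close>

lemma Lip_phiE:
  fixes g :: "(nat \<Rightarrow> 'a::metric_space) \<Rightarrow> real"
  assumes "\<And>a b :: 'a. dist a b \<le> 1" and "g \<in> Lip" and "C \<ge> 0"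
  obtains E where "E \<ge> 0" "\<And>x y. \<bar>g x - g y\<bar> \<le> E * phi C (seq_dist x y)"
proof -
  obtain K where K: "K \<ge> 0" "\<And>x y. \<bar>g x - g y\<bar> \<le> K * seq_dist x y"
    using LipE[OF assms(1,2)] by blast
  have "\<bar>g x - g y\<bar> \<le> K * exp (2 * C) * phi C (seq_dist x y)" for x y
  proof -
    have "exp (2 * C) * (exp (- 2 * C) * seq_dist x y) \<le> exp (2 * C) * phi C (seq_dist x y)"
      using assms by (intro mult_left_mono phi_ge seq_dist_nonneg seq_dist_le_1) auto
    then have "seq_dist x y \<le> exp (2 * C) * phi C (seq_dist x y)"
      by (simp add: mult.assoc[symmetric] exp_add[symmetric])
    from mult_left_mono[OF this K(1)] K(2)[of x y] show ?thesis by (simp add: mult.assoc)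
  qed
  then show ?thesis using that[of "K * exp (2 * C)"] K(1) by simp
qed

lemma phi_contraction:
  assumes "C \<ge> 0" "0 \<le> s" "s \<le> 1"
  shows "exp (- C * s) * phi C (s / 2) + (1 - exp (- C * s)) * 2 \<le> contr C * phi C s"
proof -
  \<comment> \<open>The coupling probability times the exponential in \<open>phi C (s / 2)\<close>
    is exactly the exponential in \<open>phi C s\<close>; hence the rate \<open>2 * C\<close> in
    \<open>phi\<close>.\<close>
  have "exp (- C * s) * exp (- C * s) = exp (- 2 * C * s)"
    by (simp add: exp_add[symmetric])
  then have "exp (- C * s) * phi C (s / 2) + (1 - exp (- C * s)) * 2
      = 2 - exp (- 2 * C * s) * (2 - s / 2)"
    by (simp add: phi_def algebra_simps)
  also have "\<dots> = phi C s - exp (- 2 * C * s) * s / 2"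
    by (simp add: phi_def algebra_simps)
  also have "\<dots> \<le> phi C s - exp (- 2 * C) * s / 2"
    using assms by (auto intro!: mult_right_mono mult_left_le)
  also have "\<dots> \<le> phi C s - exp (- 2 * C) / (2 * (4 * C + 1)) * phi C s"
  proof -
    have "exp (- 2 * C) / (2 * (4 * C + 1)) * phi C s
        \<le> exp (- 2 * C) / (2 * (4 * C + 1)) * ((4 * C + 1) * s)"
      using assms by (intro mult_left_mono phi_le) auto
    also have "\<dots> = exp (- 2 * C) * s / 2"
    proof -
      have "4 * C + 1 \<noteq> 0" using assms(1) by simp
      then show ?thesis unfolding times_divide_eq_left by (simp add: divide_simps)
    qed
    finally show ?thesis by simp
  qed
  finally show ?thesis by (simp add: contr_def algebra_simps)
qed

section \<open>Elementary bounds for the exponential\<close>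

lemma abs_exp_diff_le:
  fixes p q m :: real
  assumes "\<bar>p\<bar> \<le> m" "\<bar>q\<bar> \<le> m"
  shows "\<bar>exp p - exp q\<bar> \<le> exp m * \<bar>p - q\<bar>"
proof -
  have *: "exp p - exp q \<le> exp m * \<bar>p - q\<bar>" if "\<bar>p\<bar> \<le> m" for p q :: real
  proof -
    have "exp p - exp q = exp p * (1 - exp (q - p))"
      by (simp add: algebra_simps exp_add[symmetric])
    also have "\<dots> \<le> exp p * \<bar>p - q\<bar>"
    proof (rule mult_left_mono)
      show "1 - exp (q - p) \<le> \<bar>p - q\<bar>"
        using exp_ge_add_one_self[of "q - p"] by linarith
    qed simp
    also have "\<dots> \<le> exp m * \<bar>p - q\<bar>"
      using that by (intro mult_right_mono) auto
    finally show ?thesis .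
  qed
  show ?thesis using *[OF assms(1), of q] *[OF assms(2), of p] by (auto simp: abs_minus_commute)
qed

text \<open>The derivative \<open>exp z - 1\<close> of the remainder vanishes at 0, so the mean
  value theorem yields a further factor \<open>m\<close>. With \<open>m\<close> proportional to
  \<open>\<bar>t\<bar>\<close> this makes the error quadratic in \<open>t\<close>.\<close>

lemma abs_exp_remainder_diff_le:
  fixes p q m :: real
  assumes "\<bar>p\<bar> \<le> m" "\<bar>q\<bar> \<le> m"
  shows "\<bar>(exp p - 1 - p) - (exp q - 1 - q)\<bar> \<le> m * exp m * \<bar>p - q\<bar>"
proof -
  have "\<exists>z. \<bar>z\<bar> \<le> m \<and> (exp p - 1 - p) - (exp q - 1 - q) = (p - q) * (exp z - 1)"
    if "\<bar>p\<bar> \<le> m" "\<bar>q\<bar> \<le> m" "q < p" for p q :: real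
  proof -
    have "((\<lambda>s. exp s - 1 - s) has_real_derivative (exp z - 1)) (at z)" for z :: real
      by (auto intro!: derivative_eq_intros)
    from MVT2[OF that(3) this] obtain z where z: "q < z" "z < p"
      "(exp p - 1 - p) - (exp q - 1 - q) = (p - q) * (exp z - 1)"
      by blast
    moreover have "\<bar>z\<bar> \<le> m" using z(1,2) that(1,2) by linarith
    ultimately show ?thesis by blast
  qed
  note mvt = this
  have *: "\<bar>(exp p - 1 - p) - (exp q - 1 - q)\<bar> \<le> m * exp m * \<bar>p - q\<bar>"
    if pq: "\<bar>p\<bar> \<le> m" "\<bar>q\<bar> \<le> m" "q < p" for p q :: real
  proof -
    obtain z where z: "\<bar>z\<bar> \<le> m"
      "(exp p - 1 - p) - (exp q - 1 - q) = (p - q) * (exp z - 1)"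
      using mvt[OF pq] by blast
    have "\<bar>exp z - exp 0\<bar> \<le> exp m * \<bar>z - 0\<bar>"
      using z(1) by (intro abs_exp_diff_le) auto
    also have "\<dots> \<le> exp m * m" using z(1) by simp
    finally show ?thesis
      unfolding z(2) abs_mult by (simp add: mult.commute mult_left_mono)
  qed
  show ?thesis
    using *[OF assms] *[OF assms(2,1)] by (cases p q rule: linorder_cases) (auto simp: abs_minus_commute)
qed

section \<open>Ruelle operators of normalized potentials\<close>

locale ruelle_setting = prob_space \<nu> for \<nu> :: "'a::metric_space measure" +
  assumes sets_eq: "sets \<nu> = sets borel"
    and dist_le_1: "\<And>a b :: 'a. dist a b \<le> 1"
begin

text \<open>As a function of the prepended symbol, \<open>g\<close> is Lipschitz with constant
  \<open>C / 2\<close>, hence continuous.\<close>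

lemma Lip_measurable:
  assumes "g \<in> Lip"
  shows "(\<lambda>a. g (case_nat a x)) \<in> borel_measurable \<nu>"
proof -
  obtain C where C: "C \<ge> 0" "\<And>x y. \<bar>g x - g y\<bar> \<le> C * seq_dist x y"
    using LipE[OF dist_le_1 assms] by blast
  have "seq_dist x x = 0" by (simp add: seq_dist_def)
  then have "(C/2)-lipschitz_on UNIV (\<lambda>a. g (case_nat a x))"
    using C(1) C(2)[of "case_nat _ x" "case_nat _ x"]
    by (auto simp: lipschitz_on_def dist_real_def seq_dist_case_nat[OF dist_le_1])
  then have "continuous_on UNIV (\<lambda>a. g (case_nat a x))"
    by (rule lipschitz_on_continuous_on)
  then show ?thesis
    using borel_measurable_continuous_onI measurable_cong_sets[OF sets_eq refl] by blast
qed

lemma ruelle_integrable: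
  assumes "f \<in> Lip" "(\<lambda>a. g (case_nat a x)) \<in> borel_measurable \<nu>" "\<And>x. \<bar>g x\<bar> \<le> B"
  shows "integrable \<nu> (\<lambda>a. exp (f (case_nat a x)) * g (case_nat a x))"
proof -
  obtain A where A: "A \<ge> 0" "\<And>x. \<bar>f x\<bar> \<le> A" using Lip_bounded[OF dist_le_1 assms(1)] by blast
  show ?thesis
  proof (rule integrable_const_bound)
    have "norm (exp (f z) * g z) \<le> exp A * B" for z
      unfolding norm_mult using A(2)[of z] assms(3)[of z]
      by (intro mult_mono) auto
    then show "AE a in \<nu>. norm (exp (f (case_nat a x)) * g (case_nat a x)) \<le> exp A * B"
      by simp
    show "(\<lambda>a. exp (f (case_nat a x)) * g (case_nat a x)) \<in> borel_measurable \<nu>"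
      using assms(2) Lip_measurable[OF assms(1), of x] by measurable
  qed
qed

text \<open>The coupling argument, written as an inequality of integrands: the coupled part uses the
  bound at half the distance, the rest only the oscillation of \<open>g\<close>, at most
  \<open>2 * c\<close>.\<close>

lemma ruelle_contraction:
  assumes f: "f \<in> normalized_potentials \<nu>" and "C \<ge> 0"
    and fC: "\<And>x y. \<bar>f x - f y\<bar> \<le> C * seq_dist x y"
    and meas: "\<And>x. (\<lambda>a. g (case_nat a x)) \<in> borel_measurable \<nu>"
    and bd: "\<And>x. \<bar>g x\<bar> \<le> B"
    and gc: "\<And>x y. \<bar>g x - g y\<bar> \<le> c * phi C (seq_dist x y)" and "c \<ge> 0"
  shows "\<bar>ruelle \<nu> f g x - ruelle \<nu> f g y\<bar> \<le> contr C * c * phi C (seq_dist x y)"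
proof -
  have flip: "f \<in> Lip" and one: "\<And>x. (\<integral>a. exp (f (case_nat a x)) \<partial>\<nu>) = 1"
    using f by (auto simp: normalized_potentials_def ruelle_def fun_eq_iff)
  have int1: "integrable \<nu> (\<lambda>a. exp (f (case_nat a x)))" for x
    using ruelle_integrable[OF flip, of "\<lambda>_. 1" x 1] by simp
  have intg: "integrable \<nu> (\<lambda>a. exp (f (case_nat a x)) * g (case_nat a x))" for x
    by (rule ruelle_integrable[OF flip meas bd])
  define I where "I = (INF z. g z)"
  have osc: "\<bar>g p - g q\<bar> \<le> 2 * c" for p q
    using gc[of p q] mult_left_mono[OF phi_le_2[OF seq_dist_le_1[OF dist_le_1, of p q]] \<open>c \<ge> 0\<close>, of C]
    by linarith
  have I: "I \<le> g z" "g z \<le> I + 2 * c" for z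
  proof -
    have "bdd_below (range g)"
      using bd by (intro bdd_belowI2[of _ "- B"]) (metis abs_le_iff minus_le_iff)
    then show "I \<le> g z" unfolding I_def by (rule cINF_lower) simp
    have "g z - 2 * c \<le> g q" for q using osc[of z q] by linarith
    then have "g z - 2 * c \<le> I" unfolding I_def by (intro cINF_greatest) auto
    then show "g z \<le> I + 2 * c" by simp
  qed
  have "ruelle \<nu> f g x - ruelle \<nu> f g y \<le> contr C * c * phi C (seq_dist x y)" for x y
  proof -
    define s where "s = seq_dist x y"
    define \<theta> where "\<theta> = exp (- C * s)"
    have s: "0 \<le> s" "s \<le> 1"
      by (auto simp: s_def seq_dist_nonneg[OF dist_le_1] seq_dist_le_1[OF dist_le_1])
    have \<theta>: "0 < \<theta>" "\<theta> \<le> 1" using \<open>C \<ge> 0\<close> s by (auto simp: \<theta>_def)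
    have sd: "seq_dist (case_nat a x) (case_nat a y) = s / 2" for a
      by (simp add: seq_dist_case_nat[OF dist_le_1] s_def)
    \<comment> \<open>With weights X, Y and values u, v of \<open>g\<close>, X u - Y v = \<theta> X
      (u - v) + (1 - \<theta>) X u - (Y - \<theta> X) v. The first term is the coupled one; the
      others are bounded by the range of \<open>g\<close>.\<close>
    have pw: "exp (f (case_nat a x)) * g (case_nat a x) - exp (f (case_nat a y)) * g (case_nat a y)
        \<le> \<theta> * c * phi C (s / 2) * exp (f (case_nat a x))
          + (1 - \<theta>) * (I + 2 * c) * exp (f (case_nat a x))
          - I * exp (f (case_nat a y)) + \<theta> * I * exp (f (case_nat a x))" for a
    proof -
      let ?X = "exp (f (case_nat a x))" and ?Y = "exp (f (case_nat a y))"
      let ?u = "g (case_nat a x)" and ?v = "g (case_nat a y)"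
      have "\<theta> * ?X \<le> ?Y"
      proof -
        have "C * (s / 2) \<le> C * s" using \<open>C \<ge> 0\<close> s by (intro mult_left_mono) auto
        then have "- C * s + f (case_nat a x) \<le> f (case_nat a y)"
          using fC[of "case_nat a x" "case_nat a y"] unfolding sd by linarith
        then show ?thesis unfolding \<theta>_def exp_add[symmetric] by simp
      qed
      then have "(?Y - \<theta> * ?X) * I \<le> (?Y - \<theta> * ?X) * ?v"
        using I(1) by (intro mult_left_mono) auto
      moreover have "\<theta> * ?X * (?u - ?v) \<le> \<theta> * ?X * (c * phi C (s / 2))"
        using gc[of "case_nat a x" "case_nat a y"] \<theta> unfolding sd by (intro mult_left_mono) auto
      moreover have "(1 - \<theta>) * ?X * ?u \<le> (1 - \<theta>) * ?X * (I + 2 * c)"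
        using I(2) \<theta> by (intro mult_left_mono) auto
      ultimately show ?thesis by (simp add: algebra_simps)
    qed
    have "ruelle \<nu> f g x - ruelle \<nu> f g y
        = (\<integral>a. exp (f (case_nat a x)) * g (case_nat a x) - exp (f (case_nat a y)) * g (case_nat a y) \<partial>\<nu>)"
      unfolding ruelle_def using intg by simp
    also have "\<dots> \<le> (\<integral>a. \<theta> * c * phi C (s / 2) * exp (f (case_nat a x))
          + (1 - \<theta>) * (I + 2 * c) * exp (f (case_nat a x))
          - I * exp (f (case_nat a y)) + \<theta> * I * exp (f (case_nat a x)) \<partial>\<nu>)"
      using int1 intg pw by (intro integral_mono) auto
    \<comment> \<open>Both weights have total mass 1, so \<open>I\<close> is about to cancel and
      only the gap \<open>2 * c\<close> survives.\<close>
    also have "\<dots> = \<theta> * c * phi C (s / 2) + (1 - \<theta>) * (I + 2 * c) - I + \<theta> * I"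
      using int1 by (simp add: one)
    also have "\<dots> = c * (\<theta> * phi C (s / 2) + (1 - \<theta>) * 2)"
      by (simp add: algebra_simps)
    also have "\<dots> \<le> c * (contr C * phi C s)"
      unfolding \<theta>_def using \<open>C \<ge> 0\<close> \<open>c \<ge> 0\<close> s by (intro mult_left_mono phi_contraction)
    finally show ?thesis by (simp add: s_def mult_ac)
  qed
  from this[of x y] this[of y x] show ?thesis by (simp add: seq_dist_commute abs_le_iff)
qed

text \<open>\<open>r\<close> bounds the contraction factor after multiplication by
  \<open>exp (t * \<eta> z)\<close>. Fixing \<open>r < 1\<close> makes the bound uniform over small
  \<open>t\<close>.\<close>

lemma eigenfunction_estimate:
  assumes f: "f \<in> normalized_potentials \<nu>" and "C \<ge> 0"
    and fC: "\<And>x y. \<bar>f x - f y\<bar> \<le> C * seq_dist x y"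
    and \<eta>: "\<eta> \<in> ruelle_kernel \<nu> f"
    and M: "\<And>x. \<bar>\<eta> x\<bar> \<le> M"
    and E: "E \<ge> 0" "\<And>x y. \<bar>\<eta> x - \<eta> y\<bar> \<le> E * phi C (seq_dist x y)"
    and t: "\<bar>t\<bar> \<le> 1"
    and r: "r < 1" "contr C * exp (\<bar>t\<bar> * M) * (1 + 2 * \<bar>t\<bar> * E) \<le> r"
    and rpf: "rpf_triple \<nu> (\<lambda>x. f x + t * \<eta> x) l w \<rho>"
  shows "\<bar>w x - 1\<bar> \<le> 2 * (M * exp M * E / (1 - r)) * t\<^sup>2"
proof -
  let ?d = "\<lambda>x y. phi C (seq_dist x y)"
  have flip: "f \<in> Lip" and one: "\<And>x. (\<integral>a. exp (f (case_nat a x)) \<partial>\<nu>) = 1"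
    using f by (auto simp: normalized_potentials_def ruelle_def fun_eq_iff)
  have \<eta>lip: "\<eta> \<in> Lip" and \<eta>0: "\<And>x. (\<integral>a. exp (f (case_nat a x)) * \<eta> (case_nat a x) \<partial>\<nu>) = 0"
    using \<eta> by (auto simp: ruelle_kernel_def ruelle_def fun_eq_iff)
  have wlip: "w \<in> Lip" and l: "l > 0" and eig: "\<And>x. ruelle \<nu> (\<lambda>x. f x + t * \<eta> x) w x = l * w x"
    and dual: "\<And>u. u \<in> Lip \<Longrightarrow> (\<integral>x. ruelle \<nu> (\<lambda>x. f x + t * \<eta> x) u x \<partial>\<rho>) = l * (\<integral>x. u x \<partial>\<rho>)"
    and mean: "(\<integral>x. w x \<partial>\<rho>) = 1" and "prob_space \<rho>"
    using rpf by (auto simp: rpf_triple_def fun_eq_iff)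
  interpret R: prob_space \<rho> by fact
  have d0: "0 \<le> ?d x y" for x y :: "nat \<Rightarrow> 'a"
    using \<open>C \<ge> 0\<close> by (intro phi_nonneg seq_dist_nonneg seq_dist_le_1 dist_le_1)
  have d2: "?d x y \<le> 2" for x y :: "nat \<Rightarrow> 'a"
    by (intro phi_le_2 seq_dist_le_1 dist_le_1)
  have M0: "M \<ge> 0" using M[of undefined] by linarith
  have tM: "\<bar>t * \<eta> x\<bar> \<le> \<bar>t\<bar> * M" for x
    unfolding abs_mult using M by (intro mult_left_mono) auto
  have tM1: "\<bar>t\<bar> * M \<le> M" using t M0 by (simp add: mult_left_le_one_le)
  have int1: "integrable \<nu> (\<lambda>a. exp (f (case_nat a x)))" for x
    using ruelle_integrable[OF flip, of "\<lambda>_. 1" x 1] by simp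
  have int\<eta>: "integrable \<nu> (\<lambda>a. exp (f (case_nat a x)) * \<eta> (case_nat a x))" for x
    by (rule ruelle_integrable[OF flip Lip_measurable[OF \<eta>lip] M])
  have [measurable]: "(\<lambda>a. \<eta> (case_nat a x)) \<in> borel_measurable \<nu>"
    "(\<lambda>a. w (case_nat a x)) \<in> borel_measurable \<nu>" for x
    by (auto intro: Lip_measurable \<eta>lip wlip)

  obtain B where B: "B \<ge> 0" "\<And>x. \<bar>w x\<bar> \<le> B" using Lip_bounded[OF dist_le_1 wlip] by blast
  have expM: "exp (t * \<eta> x) \<le> exp M" for x using tM[of x] tM1 by simp
  have bdw: "\<bar>exp (t * \<eta> x) * w x\<bar> \<le> exp M * B" for x
    unfolding abs_mult using expM B by (intro mult_mono) auto
  have intw: "integrable \<nu> (\<lambda>a. exp (f (case_nat a x)) * (exp (t * \<eta> (case_nat a x)) * w (case_nat a x)))" for x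
    by (rule ruelle_integrable[where g="\<lambda>z. exp (t * \<eta> z) * w z", OF flip _ bdw]) measurable
  have inte: "integrable \<nu> (\<lambda>a. exp (f (case_nat a x)) * exp (t * \<eta> (case_nat a x)))" for x
    by (rule ruelle_integrable[where g="\<lambda>z. exp (t * \<eta> z)" and B="exp M", OF flip])
      (use expM in \<open>auto intro!: measurable_compose[OF _ borel_measurable_exp]\<close>)

  \<comment> \<open>The unperturbed operator maps \<open>1 + t * \<eta> z\<close>, a lower bound of
    \<open>exp (t * \<eta> z)\<close>, to 1. So the perturbed one maps 1 to a function \<ge> 1,
    whose mean is \<open>l\<close> by duality.\<close>
  have l1: "l \<ge> 1"
  proof -
    let ?L = "ruelle \<nu> (\<lambda>x. f x + t * \<eta> x) (\<lambda>_. 1)"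
    have ge: "?L x \<ge> 1" for x
    proof -
      have "1 = (\<integral>a. exp (f (case_nat a x)) + t * (exp (f (case_nat a x)) * \<eta> (case_nat a x)) \<partial>\<nu>)"
        using int1 int\<eta> by (simp add: one \<eta>0)
      also have "\<dots> \<le> (\<integral>a. exp (f (case_nat a x)) * exp (t * \<eta> (case_nat a x)) \<partial>\<nu>)"
      proof (rule integral_mono)
        fix a
        show "exp (f (case_nat a x)) + t * (exp (f (case_nat a x)) * \<eta> (case_nat a x))
          \<le> exp (f (case_nat a x)) * exp (t * \<eta> (case_nat a x))"
          using mult_left_mono[OF exp_ge_add_one_self[of "t * \<eta> (case_nat a x)"], of "exp (f (case_nat a x))"]
          by (simp add: algebra_simps)
      qed (use int1 int\<eta> inte in auto)
      also have "\<dots> = ?L x" by (simp add: ruelle_def exp_add)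
      finally show ?thesis .
    qed
    have "(\<lambda>_. 1) \<in> (Lip :: ((nat \<Rightarrow> 'a) \<Rightarrow> real) set)"
      by (auto simp: Lip_def intro!: exI[of _ 0])
    from dual[OF this] have L: "(\<integral>x. ?L x \<partial>\<rho>) = l" by (simp add: R.prob_space)
    \<comment> \<open>The integral of a non-integrable function is 0.\<close>
    then have "integrable \<rho> ?L" using l not_integrable_integral_eq by fastforce
    from integral_mono[OF _ this, of "\<lambda>_. 1"] ge have "1 \<le> (\<integral>x. ?L x \<partial>\<rho>)"
      by (simp add: R.prob_space)
    then show ?thesis using L by simp
  qed

  \<comment> \<open>As \<open>w\<close> has mean 1, \<open>w x - 1\<close> is the mean of
    \<open>w x - w y\<close> over \<open>y\<close>; the factor 2 is the upper bound of
    \<open>phi\<close>.\<close>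
  have w_osc: "\<bar>w x - 1\<bar> \<le> 2 * c" if c: "\<And>x y. \<bar>w x - w y\<bar> \<le> c * ?d x y" "c \<ge> 0" for c x
  proof -
    have int: "integrable \<rho> w" using mean not_integrable_integral_eq by fastforce
    have wxy: "\<bar>w x - w y\<bar> \<le> 2 * c" for y
      using c(1)[of x y] mult_left_mono[OF d2[of x y] c(2)] by linarith
    have "w x - 1 = (\<integral>y. w x - w y \<partial>\<rho>)" using int mean by (simp add: R.prob_space)
    also have "\<bar>\<dots>\<bar> \<le> (\<integral>y. \<bar>w x - w y\<bar> \<partial>\<rho>)" by (rule integral_abs_bound)
    also have "\<dots> \<le> (\<integral>y. 2 * c \<partial>\<rho>)"
      using int wxy by (intro integral_mono) auto
    finally show ?thesis by (simp add: R.prob_space)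
  qed

  \<comment> \<open>Self-improvement: a constant \<open>c\<close> admissible for \<open>w\<close>
    gives a new one by contracting \<open>g\<close>, whose image is
    \<open>l * w - 1\<close>.\<close>
  have improve: "\<bar>w x - w y\<bar> \<le> (M * exp M * E * t\<^sup>2 + r * c) * ?d x y"
    if c: "\<And>x y. \<bar>w x - w y\<bar> \<le> c * ?d x y" "c \<ge> 0" for c x y
  proof -
    let ?e = "\<lambda>z. exp (t * \<eta> z)"
    define g where "g = (\<lambda>z. ?e z * w z - 1 - t * \<eta> z)"
    define m where "m = \<bar>t\<bar> * M"
    define b where "b = m * exp m * \<bar>t\<bar> * E + exp m * (1 + 2 * \<bar>t\<bar> * E) * c"
    have m0: "m \<ge> 0" using M0 by (simp add: m_def)
    have b0: "b \<ge> 0" unfolding b_def using m0 E(1) c(2) by (intro add_nonneg_nonneg mult_nonneg_nonneg) auto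
    have dt: "\<bar>t * \<eta> p - t * \<eta> q\<bar> \<le> \<bar>t\<bar> * E * ?d p q" for p q
      using mult_left_mono[OF E(2)[of p q], of "\<bar>t\<bar>"]
      by (simp add: right_diff_distrib[symmetric] abs_mult mult.assoc)
    have tMm: "\<bar>t * \<eta> p\<bar> \<le> m" for p using tM by (simp add: m_def)
    have "\<bar>g p - g q\<bar> \<le> b * ?d p q" for p q
    proof -
      \<comment> \<open>The last term carries \<open>w q - 1\<close> rather than \<open>w q\<close>,
        so \<open>w_osc\<close> bounds it by a multiple of \<open>c\<close>. No term of first order
        in \<open>t\<close> is left without the factor \<open>c\<close>. The three bounds add up to
        \<open>b\<close>.\<close>
      have "g p - g q = ((?e p - 1 - t * \<eta> p) - (?e q - 1 - t * \<eta> q))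
          + ?e p * (w p - w q) + (?e p - ?e q) * (w q - 1)"
        by (simp add: g_def algebra_simps)
      moreover have "\<bar>(?e p - 1 - t * \<eta> p) - (?e q - 1 - t * \<eta> q)\<bar> \<le> m * exp m * (\<bar>t\<bar> * E * ?d p q)"
        using m0 by (intro order_trans[OF abs_exp_remainder_diff_le[OF tMm tMm] mult_left_mono[OF dt]]) simp
      moreover have "\<bar>?e p * (w p - w q)\<bar> \<le> exp m * (c * ?d p q)"
        unfolding abs_mult using tM[of p] c(1)[of p q] by (intro mult_mono) (auto simp: m_def)
      moreover have "\<bar>(?e p - ?e q) * (w q - 1)\<bar> \<le> exp m * (\<bar>t\<bar> * E * ?d p q) * (2 * c)"
      proof -
        have "\<bar>?e p - ?e q\<bar> \<le> exp m * (\<bar>t\<bar> * E * ?d p q)"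
          by (intro order_trans[OF abs_exp_diff_le[OF tMm tMm] mult_left_mono[OF dt]]) simp
        then show ?thesis
          unfolding abs_mult using w_osc[OF c, of q] d0[of p q] E(1) by (intro mult_mono) auto
      qed
      ultimately have "\<bar>g p - g q\<bar> \<le> m * exp m * (\<bar>t\<bar> * E * ?d p q) + exp m * (c * ?d p q)
          + exp m * (\<bar>t\<bar> * E * ?d p q) * (2 * c)"
        by linarith
      then show ?thesis by (simp add: b_def algebra_simps)
    qed
    moreover have "\<bar>g p\<bar> \<le> exp M * B + 1 + M" for p
      using bdw[of p] tM[of p] tM1 unfolding g_def by linarith
    moreover have "(\<lambda>a. g (case_nat a p)) \<in> borel_measurable \<nu>" for p
      unfolding g_def by measurable
    ultimately have "\<bar>ruelle \<nu> f g x - ruelle \<nu> f g y\<bar> \<le> contr C * b * ?d x y"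
      using b0 by (intro ruelle_contraction[OF f \<open>C \<ge> 0\<close> fC]) auto
    \<comment> \<open>The subtracted terms of \<open>g\<close> contribute 1 and 0, by normalization
      of \<open>f\<close> and the kernel condition on \<open>\<eta>\<close>.\<close>
    moreover have "ruelle \<nu> f g p = l * w p - 1" for p
    proof -
      have "ruelle \<nu> f g p = (\<integral>a. exp (f (case_nat a p)) * (?e (case_nat a p) * w (case_nat a p))
          - exp (f (case_nat a p)) - t * (exp (f (case_nat a p)) * \<eta> (case_nat a p)) \<partial>\<nu>)"
        by (simp add: ruelle_def g_def algebra_simps)
      also have "\<dots> = (\<integral>a. exp (f (case_nat a p)) * (?e (case_nat a p) * w (case_nat a p)) \<partial>\<nu>) - 1"
        using int1 int\<eta> intw by (simp add: one \<eta>0)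
      also have "\<dots> = l * w p - 1"
        unfolding eig[symmetric] by (simp add: ruelle_def exp_add mult.assoc)
      finally show ?thesis .
    qed
    ultimately have "l * \<bar>w x - w y\<bar> \<le> contr C * b * ?d x y"
      using l by (simp add: right_diff_distrib[symmetric] abs_mult)
    moreover have "\<bar>w x - w y\<bar> \<le> l * \<bar>w x - w y\<bar>"
      using l1 by (simp add: mult_left_le_one_le mult_le_cancel_right1)
    moreover have "contr C * b * ?d x y \<le> (M * exp M * E * t\<^sup>2 + r * c) * ?d x y"
    proof (rule mult_right_mono[OF _ d0])
      show "contr C * b \<le> M * exp M * E * t\<^sup>2 + r * c"
      proof -
        have "m * exp m * \<bar>t\<bar> * E = (M * exp m * E) * t\<^sup>2"
          by (simp add: m_def power2_eq_square abs_mult[symmetric])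
        also have "\<dots> \<le> (M * exp M * E) * t\<^sup>2"
          using tM1 M0 E(1) by (intro mult_right_mono mult_left_mono) (auto simp: m_def)
        finally have "m * exp m * \<bar>t\<bar> * E \<le> M * exp M * E * t\<^sup>2" .
        moreover have "contr C * (m * exp m * \<bar>t\<bar> * E) \<le> m * exp m * \<bar>t\<bar> * E"
          using contr_bounds[OF \<open>C \<ge> 0\<close>] m0 E(1) by (intro mult_left_le_one_le) auto
        moreover have "contr C * exp m * (1 + 2 * \<bar>t\<bar> * E) * c \<le> r * c"
          using r(2) c(2) by (intro mult_right_mono) (auto simp: m_def)
        moreover have "contr C * b = contr C * (m * exp m * \<bar>t\<bar> * E)
            + contr C * exp m * (1 + 2 * \<bar>t\<bar> * E) * c"
          by (simp add: b_def distrib_left mult.assoc)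
        ultimately show ?thesis by linarith
      qed
    qed
    ultimately show ?thesis by linarith
  qed

  \<comment> \<open>The best constant of \<open>w\<close> relative to \<open>phi\<close>. Where the
    denominator is 0 the quotient is 0 by convention; the bound with \<open>K\<close> handles those
    pairs.\<close>
  define N where "N = (SUP p. \<bar>w (fst p) - w (snd p)\<bar> / ?d (fst p) (snd p))"
  obtain K where K: "K \<ge> 0" "\<And>x y. \<bar>w x - w y\<bar> \<le> K * ?d x y"
    using Lip_phiE[OF dist_le_1 wlip \<open>C \<ge> 0\<close>] by blast
  have quot: "\<bar>w x - w y\<bar> / ?d x y \<le> c" if "\<bar>w x - w y\<bar> \<le> c * ?d x y" "c \<ge> 0" for c x y
    using that d0[of x y] by (cases "?d x y = 0") (auto simp: divide_simps)
  have "bdd_above (range (\<lambda>p. \<bar>w (fst p) - w (snd p)\<bar> / ?d (fst p) (snd p)))"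
    using K by (intro bdd_aboveI2[of _ _ K] quot) auto
  then have up: "\<bar>w x - w y\<bar> / ?d x y \<le> N" for x y
    unfolding N_def using cSUP_upper[of "(x, y)" UNIV] by fastforce
  have N0: "N \<ge> 0" using up[of undefined undefined] by simp
  have Nd: "\<bar>w x - w y\<bar> \<le> N * ?d x y" for x y
  proof (cases "?d x y = 0")
    case True then show ?thesis using K(2)[of x y] by simp
  next
    case False then show ?thesis using up[of x y] d0[of x y] by (simp add: divide_simps mult.commute)
  qed
  have r0: "r \<ge> 0"
  proof -
    have "0 \<le> contr C * exp (\<bar>t\<bar> * M) * (1 + 2 * \<bar>t\<bar> * E)"
      using contr_bounds[OF \<open>C \<ge> 0\<close>] E(1) by (intro mult_nonneg_nonneg add_nonneg_nonneg) auto
    then show ?thesis using r(2) by linarith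
  qed
  \<comment> \<open>\<open>N\<close> is itself admissible, so \<open>improve\<close> applies to it,
    and \<open>r < 1\<close> allows solving for \<open>N\<close>.\<close>
  have "N \<le> M * exp M * E * t\<^sup>2 + r * N"
  proof -
    have "0 \<le> M * exp M * E * t\<^sup>2 + r * N"
      using M0 E(1) r0 N0 by simp
    then show ?thesis
      unfolding N_def by (intro cSUP_least) (auto intro!: quot improve[OF Nd N0, unfolded N_def])
  qed
  then have "N \<le> (M * exp M * E / (1 - r)) * t\<^sup>2"
    using r(1) by (simp add: field_simps)
  then show ?thesis using w_osc[OF Nd N0, of x] by linarith
qed

end

section \<open>Differentiation of the eigenfunction at zero\<close>

theorem theorem28:
  fixes \<nu> :: "'a::metric_space measure"
    and f \<eta> :: "(nat \<Rightarrow> 'a) \<Rightarrow> real"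
    and l :: "real \<Rightarrow> real"
    and w :: "real \<Rightarrow> (nat \<Rightarrow> 'a) \<Rightarrow> real"
    and \<rho> :: "real \<Rightarrow> (nat \<Rightarrow> 'a) measure"
  assumes "compact (UNIV :: 'a set)"
    and "diameter (UNIV :: 'a set) = 1"
    and "prob_space \<nu>" and "sets \<nu> = sets borel"
    and "measure_support \<nu> = UNIV"
    and "f \<in> normalized_potentials \<nu>"
    and "\<eta> \<in> Lip" and "\<eta> \<in> ruelle_kernel \<nu> f"
    and "\<And>t. rpf_triple \<nu> (\<lambda>x. f x + t * \<eta> x) (l t) (w t) (\<rho> t)"
  shows "\<exists>c. \<forall>x. ((\<lambda>t. w t x) has_real_derivative c) (at 0)"
proof (intro exI allI)
  \<comment> \<open>The constant stays schematic until the last step sets it to 0, for every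
    \<open>x\<close>.\<close>
  fix x
  have dist1: "dist a b \<le> 1" for a b :: 'a
    using diameter_bounded_bound[OF compact_imp_bounded[OF assms(1)], of a b] assms(2) by simp
  interpret ruelle_setting \<nu>
    using assms(3,4) dist1 by (auto simp: ruelle_setting_def ruelle_setting_axioms_def)
  have "f \<in> Lip" using assms(6) by (simp add: normalized_potentials_def)
  then obtain C where C: "C \<ge> 0" "\<And>x y. \<bar>f x - f y\<bar> \<le> C * seq_dist x y"
    using LipE[OF dist1] by blast
  obtain M where M: "M \<ge> 0" "\<And>x. \<bar>\<eta> x\<bar> \<le> M" using Lip_bounded[OF dist1 assms(7)] by blast
  obtain E where E: "E \<ge> 0" "\<And>x y. \<bar>\<eta> x - \<eta> y\<bar> \<le> E * phi C (seq_dist x y)"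
    using Lip_phiE[OF dist1 assms(7) C(1)] by blast
  \<comment> \<open>The midpoint of \<open>contr C\<close> and 1 leaves room for the perturbed
    factor, which equals \<open>contr C\<close> at \<open>t = 0\<close>.\<close>
  define r where "r = (1 + contr C) / 2"
  have r: "r < 1" "contr C < r" using contr_bounds[OF C(1)] by (auto simp: r_def)
  define A where "A = 2 * (M * exp M * E / (1 - r))"
  have "((\<lambda>t. contr C * exp (\<bar>t\<bar> * M) * (1 + 2 * \<bar>t\<bar> * E)) \<longlongrightarrow> contr C * exp (\<bar>0\<bar> * M) * (1 + 2 * \<bar>0\<bar> * E)) (nhds 0)"
    by (intro tendsto_intros filterlim_ident)
  then have "eventually (\<lambda>t. contr C * exp (\<bar>t\<bar> * M) * (1 + 2 * \<bar>t\<bar> * E) < r) (nhds 0)"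
    using r(2) by (intro order_tendstoD) auto
  moreover have "eventually (\<lambda>t::real. \<bar>t\<bar> < 1) (nhds 0)"
    by (auto simp: eventually_nhds_metric dist_real_def intro!: exI[of _ 1])
  ultimately have ev: "eventually (\<lambda>t. \<bar>w t x - 1\<bar> \<le> A * t\<^sup>2) (nhds 0)"
  proof eventually_elim
    case (elim t)
    show ?case unfolding A_def
      using elim
      by (intro eigenfunction_estimate[OF assms(6) C assms(8) M(2) E _ r(1) _ assms(9)]) auto
  qed
  \<comment> \<open>\<open>nhds 0\<close>, unlike \<open>at 0\<close>, includes
    \<open>t = 0\<close>, where the estimate has right-hand side 0.\<close>
  from eventually_nhds_x_imp_x[OF ev] have w0: "w 0 x = 1" by simp
  have "((\<lambda>t. (w t x - w 0 x) / t) \<longlongrightarrow> 0) (at 0)"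
  proof (rule Lim_null_comparison)
    show "eventually (\<lambda>t. norm ((w t x - w 0 x) / t) \<le> A * \<bar>t\<bar>) (at 0)"
      unfolding eventually_at_filter
    proof (rule eventually_mono[OF ev], intro impI)
      fix t :: real
      assume "\<bar>w t x - 1\<bar> \<le> A * t\<^sup>2" "t \<noteq> 0"
      then show "norm ((w t x - w 0 x) / t) \<le> A * \<bar>t\<bar>"
        by (auto simp: w0 divide_simps power2_eq_square abs_mult[symmetric] mult.assoc)
    qed
    show "((\<lambda>t. A * \<bar>t\<bar>) \<longlongrightarrow> 0) (at 0)"
      by (auto intro!: tendsto_eq_intros)
  qed
  then show "((\<lambda>t. w t x) has_real_derivative 0) (at 0)"
    by (simp add: has_field_derivative_iff)
qed

end
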